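(* Let $\varphi$ be a self-map of $T$ such that $C_\varphi$ is bounded on $\mathcal{L}_0$. If $\lambda C_\varphi$ is hypercyclic on $\mathcal{L}_0$ for some $\lambda\in\mathbb{C}$, then for all $w\in T^*$ the sequence $\left(\lambda^n\, d(\varphi^n(w),\varphi^n(w^-))\right)_{n\in\mathbb{N}}$ is unbounded.
   Context: $T$ is an infinite, locally finite tree (connected graph without cycles, identified with its vertex set) with a chosen root $o$, in which every vertex except possibly $o$ has degree greater than $1$. $d(v,w)$ is the number of edges of the unique path joining $v$ and $w$, and $|v|=d(o,v)$. $T^*=T\setminus\{o\}$. For $v\in T^*$, the parent $v^-$ is the neighbor of $v$ on the path from $o$ to $v$. The Lipschitz space $\mathcal{L}$ is the set of $f:T\to\mathbb{C}$ with $\sup_{v\in T^*}|f(v)-f(v^-)|<\infty$, a Banach space under $\|f\|_{\mathcal{L}}=\max\{|f(o)|,\sup_{v\in T^*}|f(v)-f(v^-)|\}$. The little Lipschitz space $\mathcal{L}_0$ is the closed subspace of $f\in\mathcal{L}$ with $\lim_{|v|\to\infty}|f(v)-f(v^-)|=0$. The composition operator is $C_\varphi f=f\circ\varphi$; it is bounded on $\mathcal{L}_0$ if it maps $\mathcal{L}_0$ into itself and is a bounded operator there. A bounded operator $A$ on a Banach space is hypercyclic if there is a vector $f$ whose orbit $\{A^nf:n\ge 0\}$ is dense. $\varphi^n$ is the $n$-fold iterate of $\varphi$. *)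

theory Defs
  imports "HOL-Analysis.Analysis"
begin

text \<open>
  A simple graph is a symmetric irreflexive relation \<open>E\<close> on the vertex type; the type itself is the
  vertex set, so that functions on the tree are plain functions on that type.
\<close>

definition simple_graph :: "'v rel \<Rightarrow> bool" where
  "simple_graph E \<longleftrightarrow> sym E \<and> irrefl E"

definition path_between :: "'v rel \<Rightarrow> 'v \<Rightarrow> 'v list \<Rightarrow> 'v \<Rightarrow> bool" where
  "path_between E u p v \<longleftrightarrow>
     p \<noteq> [] \<and> hd p = u \<and> last p = v \<and> distinct p \<and> successively (\<lambda>x y. (x, y) \<in> E) p"

definition connected_graph :: "'v rel \<Rightarrow> bool" where
  "connected_graph E \<longleftrightarrow> (\<forall>u v. \<exists>p. path_between E u p v)"

text \<open>
  A cycle is given by its distinct vertices, the closing edge joining the last one to the first one.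
  The length bound excludes an edge traversed back and forth.
\<close>

definition graph_cycle :: "'v rel \<Rightarrow> 'v list \<Rightarrow> bool" where
  "graph_cycle E p \<longleftrightarrow>
     length p \<ge> 3 \<and> distinct p \<and> successively (\<lambda>x y. (x, y) \<in> E) p \<and> (last p, hd p) \<in> E"

definition tree_graph :: "'v rel \<Rightarrow> bool" where
  "tree_graph E \<longleftrightarrow> simple_graph E \<and> connected_graph E \<and> (\<nexists>p. graph_cycle E p)"

definition neighbors :: "'v rel \<Rightarrow> 'v \<Rightarrow> 'v set" where
  "neighbors E v = {w. (v, w) \<in> E}"

definition locally_finite_graph :: "'v rel \<Rightarrow> bool" where
  "locally_finite_graph E \<longleftrightarrow> (\<forall>v. finite (neighbors E v))"

definition vertex_degree :: "'v rel \<Rightarrow> 'v \<Rightarrow> nat" where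
  "vertex_degree E v = card (neighbors E v)"

text \<open>
  The definite descriptions below are meaningful in a tree, where any two vertices are joined by
  exactly one path; \<open>parent E r v\<close> is meaningful only for \<open>v \<noteq> r\<close>.
\<close>

definition the_path :: "'v rel \<Rightarrow> 'v \<Rightarrow> 'v \<Rightarrow> 'v list" where
  "the_path E u v = (THE p. path_between E u p v)"

definition tree_dist :: "'v rel \<Rightarrow> 'v \<Rightarrow> 'v \<Rightarrow> nat" where
  "tree_dist E u v = length (the_path E u v) - 1"

definition parent :: "'v rel \<Rightarrow> 'v \<Rightarrow> 'v \<Rightarrow> 'v" where
  "parent E r v = (THE u. u \<in> neighbors E v \<and> u \<in> set (the_path E r v))"

definition increment :: "'v rel \<Rightarrow> 'v \<Rightarrow> ('v \<Rightarrow> complex) \<Rightarrow> 'v \<Rightarrow> real" where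
  "increment E r f v = cmod (f v - f (parent E r v))"

definition lipschitz_space :: "'v rel \<Rightarrow> 'v \<Rightarrow> ('v \<Rightarrow> complex) set" where
  "lipschitz_space E r = {f. bdd_above (increment E r f ` (- {r}))}"

definition lipschitz_norm :: "'v rel \<Rightarrow> 'v \<Rightarrow> ('v \<Rightarrow> complex) \<Rightarrow> real" where
  "lipschitz_norm E r f = max (cmod (f r)) (SUP v \<in> - {r}. increment E r f v)"

text \<open>The filter expresses the limit as the distance of \<open>v\<close> to the root tends to infinity.\<close>

definition little_lipschitz_space :: "'v rel \<Rightarrow> 'v \<Rightarrow> ('v \<Rightarrow> complex) set" where
  "little_lipschitz_space E r =
     {f \<in> lipschitz_space E r. (increment E r f \<longlongrightarrow> 0) (filtercomap (tree_dist E r) at_top)}"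

text \<open>
  Boundedness, density and hypercyclicity for maps on a linear space \<open>X\<close> of complex functions with
  pointwise operations and norm \<open>N\<close>.
\<close>

definition bounded_operator_on ::
    "('v \<Rightarrow> complex) set \<Rightarrow> (('v \<Rightarrow> complex) \<Rightarrow> real) \<Rightarrow> (('v \<Rightarrow> complex) \<Rightarrow> 'v \<Rightarrow> complex) \<Rightarrow> bool" where
  "bounded_operator_on X N A \<longleftrightarrow>
     (\<forall>f\<in>X. A f \<in> X) \<and>
     (\<forall>f\<in>X. \<forall>g\<in>X. A (\<lambda>v. f v + g v) = (\<lambda>v. A f v + A g v)) \<and>
     (\<forall>c. \<forall>f\<in>X. A (\<lambda>v. c * f v) = (\<lambda>v. c * A f v)) \<and>
     (\<exists>K. \<forall>f\<in>X. N (A f) \<le> K * N f)"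

definition norm_dense_in ::
    "('v \<Rightarrow> complex) set \<Rightarrow> (('v \<Rightarrow> complex) \<Rightarrow> real) \<Rightarrow> ('v \<Rightarrow> complex) set \<Rightarrow> bool" where
  "norm_dense_in X N S \<longleftrightarrow> S \<subseteq> X \<and> (\<forall>g\<in>X. \<forall>\<epsilon>>0. \<exists>h\<in>S. N (\<lambda>v. h v - g v) < \<epsilon>)"

definition hypercyclic_on ::
    "('v \<Rightarrow> complex) set \<Rightarrow> (('v \<Rightarrow> complex) \<Rightarrow> real) \<Rightarrow> (('v \<Rightarrow> complex) \<Rightarrow> 'v \<Rightarrow> complex) \<Rightarrow> bool" where
  "hypercyclic_on X N A \<longleftrightarrow>
     bounded_operator_on X N A \<and> (\<exists>f\<in>X. norm_dense_in X N (range (\<lambda>n. (A ^^ n) f)))"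

definition composition_operator :: "('v \<Rightarrow> 'v) \<Rightarrow> ('v \<Rightarrow> complex) \<Rightarrow> 'v \<Rightarrow> complex" where
  "composition_operator \<phi> f = f \<circ> \<phi>"

end

theory Submission
  imports Defs
begin

text \<open>
  If \<open>f\<close> has a dense orbit, then the increments at \<open>w\<close> of the vectors in the orbit are unbounded, since
  the little Lipschitz space contains functions with an arbitrarily large increment at \<open>w\<close>, namely
  the multiples of \<open>v \<mapsto> min \<bar>v\<bar> \<bar>w\<bar>\<close>.  The
  increment at \<open>w\<close> of the \<open>n\<close>-th vector of the orbit is
  \<open>\<bar>c\<bar> ^ n * \<bar>f (\<phi>\<^sup>n w) - f (\<phi>\<^sup>n w\<^sup>-)\<bar>\<close>, which by the triangle inequality along the path
  from \<open>\<phi>\<^sup>n w\<close> to \<open>\<phi>\<^sup>n w\<^sup>-\<close> is at most \<open>\<bar>c\<bar> ^ n * d(\<phi>\<^sup>n w, \<phi>\<^sup>n w\<^sup>-)\<close> times the Lipschitz constant of \<open>f\<close>.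
\<close>

section \<open>Uniqueness of paths in a tree\<close>

lemma path_between_self: "path_between E u p u \<Longrightarrow> p = [u]"
  by (cases p) (auto simp: path_between_def split: if_splits)

lemma path_between_Cons:
  "path_between E u (u # p) v \<longleftrightarrow>
     (if p = [] then u = v else (u, hd p) \<in> E \<and> u \<notin> set p \<and> path_between E (hd p) p v)"
  by (cases p) (auto simp: path_between_def)

text \<open>Induction along the first path. If the two paths leave \<open>u\<close> by different
  edges, following the first until it meets the second and returning along the second closes a cycle
  through \<open>u\<close>.\<close>

lemma path_between_unique:
  assumes T: "tree_graph E" and "path_between E u p v" "path_between E u q v"
  shows "p = q"
  using assms(2,3)
proof (induction p arbitrary: u q)
  case Nil
  then show ?case by (simp add: path_between_def)
next
  case (Cons u' p)
  have symE: "sym E" using T by (simp add: tree_graph_def simple_graph_def)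
  have [simp]: "u' = u" using Cons.prems(1) by (simp add: path_between_def)
  show ?case
  proof (cases "u = v")
    case True
    then show ?thesis using Cons.prems path_between_self by metis
  next
    case False
    obtain q' where q: "q = u # q'"
      using Cons.prems(2) by (cases q) (auto simp: path_between_def)
    have pu: "(u, hd p) \<in> E" "u \<notin> set p" "path_between E (hd p) p v" "p \<noteq> []"
      using Cons.prems(1) False by (auto simp: path_between_Cons split: if_splits)
    have qu: "(u, hd q') \<in> E" "u \<notin> set q'" "path_between E (hd q') q' v" "q' \<noteq> []"
      using Cons.prems(2) False by (auto simp: q path_between_Cons split: if_splits)
    show ?thesis
    proof (cases "hd p = hd q'")
      case True
      then show ?thesis using Cons.IH pu qu q by force
    next
      case False
      have "v \<in> set p" "v \<in> set q'"
        using pu(3,4) qu(3,4) by (metis last_in_set path_between_def)+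
      \<comment> \<open>Taking \<open>x\<close> as the first vertex of \<open>p\<close> on
        \<open>q'\<close> keeps \<open>p1\<close> disjoint from \<open>q'\<close>; this makes the
        vertices of the cycle below distinct.\<close>
      then obtain p1 x p2 where p: "p = p1 @ x # p2" "x \<in> set q'" "\<forall>y\<in>set p1. y \<notin> set q'"
        using split_list_first_prop[of p "\<lambda>x. x \<in> set q'"] by blast
      then obtain q1 q2 where q': "q' = q1 @ x # q2" by (meson split_list)
      \<comment> \<open>The vertex \<open>x\<close> cannot be the head of both paths, so the cycle
        has a third vertex besides \<open>u\<close> and \<open>x\<close>.\<close>
      have ne: "p1 \<noteq> [] \<or> q1 \<noteq> []" using False p(1) q' by auto
      have sp: "successively (\<lambda>x y. (x, y) \<in> E) (p1 @ [x])"
        using pu(3) by (auto simp: path_between_def p(1) successively_append_iff)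
      have "successively (\<lambda>x y. (x, y) \<in> E) (q1 @ [x])"
        using qu(3) by (auto simp: path_between_def q' successively_append_iff)
      then have "successively (\<lambda>x y. (y, x) \<in> E) (rev (q1 @ [x]))"
        by (simp only: successively_rev)
      then have sq: "successively (\<lambda>x y. (x, y) \<in> E) (x # rev q1)"
        using symE by (auto simp: sym_def elim: successively_mono)
      have "graph_cycle E (u # p1 @ x # rev q1)"
        unfolding graph_cycle_def
      proof (intro conjI)
        show "3 \<le> length (u # p1 @ x # rev q1)"
          using ne by (cases p1; cases q1) auto
        show "distinct (u # p1 @ x # rev q1)"
          using pu qu p q' by (auto simp: path_between_def)
        have "successively (\<lambda>x y. (x, y) \<in> E) (p1 @ x # rev q1)"
          using sp sq by (simp add: successively_append_iff)
        then show "successively (\<lambda>x y. (x, y) \<in> E) (u # p1 @ x # rev q1)"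
          using pu(1) by (cases p1) (auto simp: p(1))
        have "last (u # p1 @ x # rev q1) = hd q'"
          using q' by (cases q1) auto
        then show "(last (u # p1 @ x # rev q1), hd (u # p1 @ x # rev q1)) \<in> E"
          using qu(1) symE by (auto simp: sym_def)
      qed
      then show ?thesis using T by (auto simp: tree_graph_def)
    qed
  qed
qed

lemma the_path_eq: "tree_graph E \<Longrightarrow> path_between E u p v \<Longrightarrow> the_path E u v = p"
  unfolding the_path_def using path_between_unique by (metis the_equality)

lemma path_between_the_path:
  assumes "tree_graph E" shows "path_between E u (the_path E u v) v"
proof -
  obtain p where "path_between E u p v"
    using assms unfolding tree_graph_def connected_graph_def by blast
  then show ?thesis using the_path_eq[OF assms] by metis
qed

section \<open>Parents and heights\<close>

text \<open>If \<open>u\<close> came earlier than the last place but one, the segment from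
  \<open>u\<close> to \<open>v\<close> together with the edge from \<open>v\<close> back to
  \<open>u\<close> would be a cycle.\<close>

lemma neighbor_in_path:
  assumes T: "tree_graph E" and p: "path_between E s p v"
    and u: "(v, u) \<in> E" "u \<in> set p"
  obtains p' where "p = p' @ [u, v]"
proof -
  obtain p1 p2 where p12: "p = p1 @ u # p2" using u(2) by (meson split_list)
  have "u \<noteq> v" using T u(1) by (auto simp: tree_graph_def simple_graph_def irrefl_def)
  then have "p2 \<noteq> []" using p by (auto simp: path_between_def p12)
  then have "last p2 = v" using p by (auto simp: path_between_def p12)
  have "length p2 = 1"
  proof (rule ccontr)
    assume "length p2 \<noteq> 1"
    then have "length p2 \<ge> 2" using \<open>p2 \<noteq> []\<close> by (cases p2; cases "tl p2") auto
    then have "graph_cycle E (u # p2)"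
      using p u(1) \<open>p2 \<noteq> []\<close> \<open>last p2 = v\<close>
      by (auto simp: graph_cycle_def path_between_def p12 successively_append_iff)
    then show False using T by (auto simp: tree_graph_def)
  qed
  then have "p2 = [v]" using \<open>last p2 = v\<close> by (cases p2) auto
  then show ?thesis using p12 that by simp
qed

text \<open>A neighbor of \<open>v\<close> on the root path must be its penultimate vertex, hence is
  unique; this justifies the definite description in \<open>parent\<close>.\<close>

lemma parentI:
  assumes T: "tree_graph E" and "(v, u) \<in> E" "u \<in> set (the_path E r v)"
  shows "parent E r v = u"
  unfolding parent_def
proof (rule the_equality)
  show "u \<in> neighbors E v \<and> u \<in> set (the_path E r v)"
    using assms by (simp add: neighbors_def)
next
  fix x assume x: "x \<in> neighbors E v \<and> x \<in> set (the_path E r v)"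
  obtain p' where p': "the_path E r v = p' @ [u, v]"
    using neighbor_in_path[OF T path_between_the_path[OF T] assms(2,3)] by metis
  obtain p'' where "the_path E r v = p'' @ [x, v]"
    using neighbor_in_path[OF T path_between_the_path[OF T], of v x r] x
    by (auto simp: neighbors_def)
  with p' show "x = u" by simp
qed

text \<open>Deleting \<open>v\<close> from the end of its root path leaves the root path of the
  penultimate vertex, which is the parent.\<close>

lemma tree_dist_parent:
  assumes T: "tree_graph E" and "v \<noteq> r"
  shows "tree_dist E r v = Suc (tree_dist E r (parent E r v))"
proof -
  define p where "p = the_path E r v"
  have p: "path_between E r p v" using path_between_the_path[OF T] by (simp add: p_def)
  have bl: "butlast p \<noteq> []" and pe: "p = butlast p @ [v]"
    using p assms(2) by (cases p; auto simp: path_between_def split: if_splits)+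
  define q where "q = butlast (butlast p)"
  define u where "u = last (butlast p)"
  have pq: "p = q @ [u, v]" using bl pe by (metis append.assoc append_Cons append_Nil append_butlast_last_id q_def u_def)
  have "successively (\<lambda>x y. (x, y) \<in> E) (q @ [u])"
    using p by (simp add: path_between_def pq successively_append_iff)
  then have path: "path_between E r (q @ [u]) u"
    using p by (cases q) (auto simp: path_between_def pq)
  have "(u, v) \<in> E" using p by (auto simp: path_between_def pq successively_append_iff)
  then have "(v, u) \<in> E" using T by (auto simp: tree_graph_def simple_graph_def sym_def)
  then have "parent E r v = u" by (rule parentI[OF T]) (simp add: p_def[symmetric] pq)
  then show ?thesis
    using the_path_eq[OF T path] pq by (simp add: tree_dist_def flip: p_def)
qed

text \<open>Either \<open>b\<close> lies on the root path of \<open>a\<close>, or appending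
  \<open>b\<close> to that path gives the root path of \<open>b\<close>. Thus a bound on the
  increments controls the differences across all edges.\<close>

lemma edge_parent:
  assumes T: "tree_graph E" and e: "(a, b) \<in> E"
  shows "(a \<noteq> r \<and> parent E r a = b) \<or> (b \<noteq> r \<and> parent E r b = a)"
proof -
  have ab: "a \<noteq> b" "(b, a) \<in> E"
    using T e by (auto simp: tree_graph_def simple_graph_def irrefl_def sym_def)
  have p: "path_between E r (the_path E r a) a" by (rule path_between_the_path[OF T])
  show ?thesis
  proof (cases "b \<in> set (the_path E r a)")
    case True
    then have "a \<noteq> r" using p ab path_between_self by fastforce
    then show ?thesis using parentI[OF T e True] by simp
  next
    case False
    then have "path_between E r (the_path E r a @ [b]) b"
      using p e by (auto simp: path_between_def successively_append_iff)
    then have q: "the_path E r b = the_path E r a @ [b]" by (rule the_path_eq[OF T])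
    \<comment> \<open>The root lies on the path to \<open>a\<close> while \<open>b\<close> does not,
      so \<open>b\<close> is not the root.\<close>
    have "a \<in> set (the_path E r b)" "r \<in> set (the_path E r a)"
      using p last_in_set hd_in_set by (fastforce simp: q path_between_def)+
    then show ?thesis using parentI[OF T ab(2)] False by auto
  qed
qed

section \<open>Estimates in the Lipschitz spaces\<close>

lemma lipschitz_along_path:
  assumes "\<And>a b. (a, b) \<in> E \<Longrightarrow> cmod (f a - f b) \<le> L"
  shows "path_between E u p v \<Longrightarrow> cmod (f u - f v) \<le> L * real (length p - 1)"
proof (induction p arbitrary: u)
  case Nil
  then show ?case by (simp add: path_between_def)
next
  case (Cons u' p)
  have [simp]: "u' = u" using Cons.prems by (simp add: path_between_def)
  show ?case
  proof (cases "p = []")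
    case True
    then show ?thesis using Cons.prems by (simp add: path_between_Cons)
  next
    case False
    then have "(u, hd p) \<in> E" "path_between E (hd p) p v"
      using Cons.prems by (auto simp: path_between_Cons)
    then have "cmod (f u - f (hd p)) \<le> L" "cmod (f (hd p) - f v) \<le> L * real (length p - 1)"
      using assms Cons.IH by auto
    moreover have "cmod (f u - f v) \<le> cmod (f u - f (hd p)) + cmod (f (hd p) - f v)"
      using norm_triangle_ineq[of "f u - f (hd p)" "f (hd p) - f v"] by simp
    moreover have "real (length (u' # p) - 1) = real (length p - 1) + 1"
      using False by (cases p) auto
    then have "L * real (length (u' # p) - 1) = L * real (length p - 1) + L"
      by (simp only: distrib_left mult_1_right)
    ultimately show ?thesis by linarith
  qed
qed

lemma increment_le_SUP:
  "f \<in> lipschitz_space E r \<Longrightarrow> v \<noteq> r \<Longrightarrow>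
     increment E r f v \<le> (SUP v \<in> - {r}. increment E r f v)"
  by (auto simp: lipschitz_space_def intro!: cSUP_upper)

lemma lipschitz_tree_dist:
  assumes T: "tree_graph E" and f: "f \<in> lipschitz_space E r"
  shows "cmod (f u - f v) \<le> (SUP v \<in> - {r}. increment E r f v) * real (tree_dist E u v)"
  unfolding tree_dist_def
proof (rule lipschitz_along_path[OF _ path_between_the_path[OF T]])
  fix a b assume "(a, b) \<in> E"
  then show "cmod (f a - f b) \<le> (SUP v \<in> - {r}. increment E r f v)"
    using edge_parent[OF T, of a b r] increment_le_SUP[OF f, of a] increment_le_SUP[OF f, of b]
    by (metis increment_def norm_minus_commute)
qed

text \<open>Membership of the difference makes the supremum in its norm a genuine upper bound, so
  that closeness in norm controls each increment.\<close>

lemma lipschitz_space_diff: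
  assumes "f \<in> lipschitz_space E r" "g \<in> lipschitz_space E r"
  shows "(\<lambda>v. f v - g v) \<in> lipschitz_space E r"
proof -
  have "increment E r (\<lambda>v. f v - g v) v
      \<le> (SUP v \<in> - {r}. increment E r f v) + (SUP v \<in> - {r}. increment E r g v)"
    if "v \<noteq> r" for v
  proof -
    have "increment E r (\<lambda>v. f v - g v) v \<le> increment E r f v + increment E r g v"
      using norm_triangle_ineq4[of "f v - f (parent E r v)" "g v - g (parent E r v)"]
      by (simp add: increment_def algebra_simps)
    then show ?thesis
      using increment_le_SUP[OF assms(1) that] increment_le_SUP[OF assms(2) that] by linarith
  qed
  then show ?thesis unfolding lipschitz_space_def by (auto intro!: bdd_aboveI2)
qed

text \<open>Height grows by one from parent to child, so the increments have modulus
  \<open>\<bar>K\<bar>\<close> up to height \<open>m\<close> and vanish beyond it.\<close>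

lemma truncated_height_little_lipschitz:
  fixes K :: real and E :: "'v rel" and r :: 'v and m :: nat
  assumes T: "tree_graph E"
  defines "g \<equiv> \<lambda>v. complex_of_real (K * real (min (tree_dist E r v) m))"
  shows "g \<in> little_lipschitz_space E r"
proof -
  have inc: "increment E r g v = (if tree_dist E r v \<le> m then \<bar>K\<bar> else 0)" if "v \<noteq> r" for v
  proof -
    have "g v - g (parent E r v) = complex_of_real (if tree_dist E r v \<le> m then K else 0)"
      using tree_dist_parent[OF T that] by (auto simp: g_def min_def algebra_simps)
    then show ?thesis by (simp add: increment_def)
  qed
  then have "g \<in> lipschitz_space E r"
    by (auto simp: lipschitz_space_def intro!: bdd_aboveI2[where M = "\<bar>K\<bar>"])
  moreover have "\<forall>\<^sub>F v in filtercomap (tree_dist E r) at_top. increment E r g v = 0"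
  proof -
    \<comment> \<open>The root has no meaningful parent; its height 0 excludes it from the vertices
      of height above \<open>m\<close>.\<close>
    have "tree_dist E r r = 0"
      using path_between_self[OF path_between_the_path[OF T]] by (simp add: tree_dist_def)
    then have "increment E r g v = 0" if "tree_dist E r v > m" for v
      using inc[of v] that by (cases "v = r") auto
    moreover have "\<forall>\<^sub>F v in filtercomap (tree_dist E r) at_top. tree_dist E r v > m"
      by (rule eventually_filtercomapI) (rule eventually_gt_at_top)
    ultimately show ?thesis by (auto elim: eventually_mono)
  qed
  ultimately show ?thesis
    by (auto simp: little_lipschitz_space_def intro: tendsto_eventually)
qed

section \<open>Increments along the orbit\<close>

lemma weighted_composition_funpow:
  "((\<lambda>f v. c * composition_operator \<phi> f v) ^^ n) f = (\<lambda>v. c ^ n * f ((\<phi> ^^ n) v))"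
  by (induction n) (auto simp: composition_operator_def funpow_swap1)

theorem proposition5p4:
  fixes E :: "'v rel" and r :: 'v and \<phi> :: "'v \<Rightarrow> 'v" and c :: complex
  assumes "tree_graph E"
    and "infinite (UNIV :: 'v set)"
    and "locally_finite_graph E"
    and "\<forall>v. v \<noteq> r \<longrightarrow> vertex_degree E v > 1"
    and "bounded_operator_on (little_lipschitz_space E r) (lipschitz_norm E r)
           (composition_operator \<phi>)"
    and "hypercyclic_on (little_lipschitz_space E r) (lipschitz_norm E r)
           (\<lambda>f v. c * composition_operator \<phi> f v)"
  shows "\<forall>w. w \<noteq> r \<longrightarrow>
           \<not> bounded (range (\<lambda>n. c ^ n *
               of_nat (tree_dist E ((\<phi> ^^ n) w) ((\<phi> ^^ n) (parent E r w)))))"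
proof (intro allI impI notI)
  fix w
  let ?X = "little_lipschitz_space E r" and ?N = "lipschitz_norm E r"
  let ?A = "\<lambda>f v. c * composition_operator \<phi> f v"
  let ?d = "\<lambda>n. tree_dist E ((\<phi> ^^ n) w) ((\<phi> ^^ n) (parent E r w))"
  assume w: "w \<noteq> r" and "bounded (range (\<lambda>n. c ^ n * of_nat (?d n)))"
  then obtain M where M: "\<And>n. cmod (c ^ n) * real (?d n) \<le> M"
    by (auto simp: bounded_iff norm_mult)
  note T = \<open>tree_graph E\<close>
  obtain f where f: "f \<in> ?X" "norm_dense_in ?X ?N (range (\<lambda>n. (?A ^^ n) f))"
    using assms(6) by (auto simp: hypercyclic_on_def)
  have fL: "f \<in> lipschitz_space E r" using f(1) by (simp add: little_lipschitz_space_def)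
  define L where "L = (SUP v \<in> - {r}. increment E r f v)"
  \<comment> \<open>Nonnegativity of \<open>L\<close> allows the bound \<open>M\<close> to be
    multiplied by \<open>L\<close> at the end.\<close>
  have "0 \<le> increment E r f w" by (simp add: increment_def)
  also have "\<dots> \<le> L" unfolding L_def by (rule increment_le_SUP[OF fL w])
  finally have L: "L \<ge> 0" .
  \<comment> \<open>All orbit increments at \<open>w\<close> are at most \<open>M * L\<close>,
    whereas an orbit vector within distance less than 1 of \<open>g\<close> has increment above
    \<open>K - 1 = M * L\<close>.\<close>
  define K where "K = M * L + 1"
  \<comment> \<open>Truncation at the height of \<open>w\<close> still lets \<open>g\<close> jump by
    \<open>K\<close> from the parent of \<open>w\<close> to \<open>w\<close>.\<close>
  define g where "g = (\<lambda>v. complex_of_real (K * real (min (tree_dist E r v) (tree_dist E r w))))"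
  have gX: "g \<in> ?X" unfolding g_def by (rule truncated_height_little_lipschitz[OF T])
  obtain n where n: "?N (\<lambda>v. (?A ^^ n) f v - g v) < 1"
    using f(2) gX unfolding norm_dense_in_def by (force dest: bspec spec[of _ 1])
  define h where "h = (?A ^^ n) f"
  have "h \<in> ?X" using f(2) by (auto simp: norm_dense_in_def h_def)
  then have "(\<lambda>v. h v - g v) \<in> lipschitz_space E r"
    using gX by (auto simp: little_lipschitz_space_def intro: lipschitz_space_diff)
  then have "increment E r (\<lambda>v. h v - g v) w < 1"
    using increment_le_SUP[OF _ w] n by (fastforce simp: lipschitz_norm_def h_def[symmetric])
  moreover have "g w - g (parent E r w) = complex_of_real K"
    using tree_dist_parent[OF T w] by (simp add: g_def algebra_simps)
  then have "increment E r (\<lambda>v. h v - g v) w = cmod (complex_of_real K - (h w - h (parent E r w)))"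
    by (simp add: increment_def norm_minus_commute algebra_simps)
  moreover have "cmod (complex_of_real K) - cmod (h w - h (parent E r w))
      \<le> cmod (complex_of_real K - (h w - h (parent E r w)))"
    by (rule norm_triangle_ineq2)
  moreover have "K \<le> cmod (complex_of_real K)" by simp
  moreover have "cmod (h w - h (parent E r w)) \<le> M * L"
  proof -
    have "cmod (h w - h (parent E r w))
        = cmod (c ^ n) * cmod (f ((\<phi> ^^ n) w) - f ((\<phi> ^^ n) (parent E r w)))"
      by (simp add: h_def weighted_composition_funpow flip: right_diff_distrib norm_mult)
    also have "\<dots> \<le> cmod (c ^ n) * (L * real (?d n))"
      unfolding L_def by (intro mult_left_mono lipschitz_tree_dist[OF T fL]) auto
    also have "\<dots> \<le> M * L" using mult_right_mono[OF M[of n] L] by (simp add: algebra_simps)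
    finally show ?thesis .
  qed
  ultimately show False by (simp add: K_def)
qed

end
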